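(* Let $n,c\ge 1$ be integers, and put $\ell = nc$ and $m = 2^{(n+1)^{(c+1)n}}$. Let $f:[\{0,1,\dots,(2m-1)^\ell-1\}]^2\to\{0,1,\dots,c-1\}$ be any function, and let $<^*$ be any linear order on $\{0,1,\dots,n-2\}$. Then there are integers $0\le a_0<a_1<\dots<a_{n-1}<(2m-1)^\ell$ such that: (a) $f$ is constant on $[\{a_0,\dots,a_{n-1}\}]^2$; and (b) the differences $b_i := a_{i+1}-a_i$ (for $0\le i<n-1$) are pairwise distinct and are ordered according to $<^*$, i.e. for all $i,j\in\{0,\dots,n-2\}$, $i<^*j$ implies $b_i<b_j$.
   Context: For a set $A$, $[A]^2$ denotes the set of all 2-element subsets of $A$. The set $\{0,1,\dots,n-2\}$ is empty when $n=1$. *)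

theory Defs
  imports "HOL-Library.Ramsey"
begin

end

theory Submission
  imports Defs
begin

text \<open>Integers are read as digit strings in a large base whose digits are less than half the base, so
  that the size of a difference is governed by the topmost digit in which the two numbers differ.
  The induction is on the number \<open>d\<close> of differences and the number \<open>c\<close> of colours. Cut the digits into a
  top and a bottom block. Every way of completing the top strings by bottom strings colours the pairs
  of top strings, and by induction there is a homogeneous set \<open>V\<close> of colour \<open>k\<close> in the top block that
  has the prescribed order of differences with the smallest difference removed. There are few
  candidates \<open>(V, k)\<close>; by double counting, some candidate stays valid while the completion of the
  element of \<open>V\<close> that should be doubled ranges over a dense subset of its bottom block. That subset
  contains a smaller tree. If some pair of the tree has colour \<open>k\<close>, it supplies the missing smallest
  difference; otherwise the tree is coloured with one colour less.\<close>

section \<open>Digit trees: size, cutting at a level, existence, thinning\<close>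

text \<open>A tree with branching numbers \<open>2 ^ e\<close>, the topmost digit first, as its set of leaves. The
  digits offered at a node may depend on the node.\<close>

primrec tree :: "nat \<Rightarrow> nat list \<Rightarrow> nat set \<Rightarrow> bool" where
  "tree B [] A \<longleftrightarrow> A = {0}"
| "tree B (e # es) A \<longleftrightarrow> (\<exists>D F. D \<subseteq> {d. 2 * d < B} \<and> finite D \<and> card D = 2 ^ e \<and>
     (\<forall>d\<in>D. tree B es (F d)) \<and> A = (\<Union>d\<in>D. (\<lambda>x. d * B ^ length es + x) ` F d))"

text \<open>Since \<open>2 * d < B\<close> gives \<open>2 * d + 1 \<le> B\<close>, the half-range
  condition passes from single digits to whole strings. It is what keeps lower digits from
  disturbing the order of differences.\<close>

lemma tree_bound: "tree B es A \<Longrightarrow> x \<in> A \<Longrightarrow> 2 * x < B ^ length es"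
proof (induction es arbitrary: A x)
  case (Cons e es)
  from Cons.prems obtain D F where "D \<subseteq> {d. 2 * d < B}" "\<forall>d\<in>D. tree B es (F d)"
    "x \<in> (\<Union>d\<in>D. (\<lambda>x. d * B ^ length es + x) ` F d)" by auto
  then obtain d y where d: "2 * d < B" "tree B es (F d)" "y \<in> F d"
    and x: "x = d * B ^ length es + y" by blast
  have "2 * y < B ^ length es" using Cons.IH d by blast
  then have "2 * x < (2 * d + 1) * B ^ length es" using x by (simp add: algebra_simps)
  also have "\<dots> \<le> B * B ^ length es" using d(1) by (intro mult_right_mono) auto
  finally show ?case by simp
qed simp

lemma digit_eqD:
  fixes d y R :: nat
  assumes "d * R + y = d' * R + y'" "2 * y < R" "2 * y' < R"
  shows "d = d'" "y = y'"
proof -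
  have "(d * R + y) div R = d" "(d' * R + y') div R = d'" using assms(2,3) by auto
  then show "d = d'" using assms(1) by simp
  then show "y = y'" using assms(1) by simp
qed

lemma tree_disjoint:
  assumes "\<And>d. d \<in> D \<Longrightarrow> tree B es (F d)" "d \<in> D" "d' \<in> D" "d \<noteq> d'"
  shows "(\<lambda>x. d * B ^ length es + x) ` F d \<inter> (\<lambda>x. d' * B ^ length es + x) ` F d' = {}"
proof -
  have "False" if "x \<in> F d" "x' \<in> F d'" "d * B ^ length es + x = d' * B ^ length es + x'" for x x'
    using digit_eqD(1)[OF that(3)] tree_bound[OF assms(1)] assms(2-4) that(1,2) by blast
  then show ?thesis by blast
qed

lemma tree_card: "tree B es A \<Longrightarrow> finite A \<and> card A = 2 ^ sum_list es"
proof (induction es arbitrary: A)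
  case (Cons e es)
  from Cons.prems obtain D F where D: "finite D" "card D = 2 ^ e"
    "\<And>d. d \<in> D \<Longrightarrow> tree B es (F d)"
    and A: "A = (\<Union>d\<in>D. (\<lambda>x. d * B ^ length es + x) ` F d)" by auto
  have F: "finite (F d)" "card (F d) = 2 ^ sum_list es" if "d \<in> D" for d
    using Cons.IH D(3) that by auto
  have "card A = (\<Sum>d\<in>D. card ((\<lambda>x. d * B ^ length es + x) ` F d))"
    unfolding A
  proof (intro card_UN_disjoint ballI impI)
    fix i j assume "i \<in> D" "j \<in> D" "i \<noteq> j"
    then show "(\<lambda>x. i * B ^ length es + x) ` F i \<inter> (\<lambda>x. j * B ^ length es + x) ` F j = {}"
      by (rule tree_disjoint[rotated]) (rule D(3))
  qed (use D F in auto)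
  also have "\<dots> = (\<Sum>d\<in>D. 2 ^ sum_list es)"
    using F by (intro sum.cong refl) (simp add: card_image)
  finally show ?case using D F A by (simp add: power_add)
qed simp

lemma tree_finite: "tree B es A \<Longrightarrow> finite A"
  using tree_card by blast

lemma tree_nonempty: "tree B es A \<Longrightarrow> A \<noteq> {}"
  using tree_card[of B es A] by (metis card.empty power_eq_0_iff zero_neq_numeral)

lemma tree_append:
  "tree B (es @ fs) A \<Longrightarrow> \<exists>X F. tree B es X \<and> (\<forall>v\<in>X. tree B fs (F v)) \<and>
     A = (\<Union>v\<in>X. (\<lambda>x. v * B ^ length fs + x) ` F v)"
proof (induction es arbitrary: A)
  case Nil
  then show ?case by (intro exI[of _ "{0}"] exI[of _ "\<lambda>_. A"]) auto
next
  case (Cons e es)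
  define R where "R = B ^ length es"
  define S where "S = B ^ length fs"
  from Cons.prems obtain D F where D: "D \<subseteq> {d. 2 * d < B}" "finite D" "card D = 2 ^ e"
    "\<And>d. d \<in> D \<Longrightarrow> tree B (es @ fs) (F d)"
    and A: "A = (\<Union>d\<in>D. (\<lambda>x. d * (R * S) + x) ` F d)"
    by (auto simp: R_def S_def power_add)
  from Cons.IH[OF D(4)] obtain X G where X: "\<And>d. d \<in> D \<Longrightarrow> tree B es (X d)"
    and G: "\<And>d v. d \<in> D \<Longrightarrow> v \<in> X d \<Longrightarrow> tree B fs (G d v)"
    and F: "\<And>d. d \<in> D \<Longrightarrow> F d = (\<Union>v\<in>X d. (\<lambda>x. v * S + x) ` G d v)"
    unfolding S_def by metis
  define Y where "Y = (\<Union>d\<in>D. (\<lambda>x. d * R + x) ` X d)"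
  \<comment> \<open>A string \<open>w = d * R + v\<close> with \<open>2 * v < R\<close> determines
    \<open>d\<close> and \<open>v\<close> by division, so the bottom trees can be reindexed by
    \<open>w\<close>.\<close>
  define H where "H = (\<lambda>w. G (w div R) (w mod R))"
  have H: "H (d * R + v) = G d v" if "d \<in> D" "v \<in> X d" for d v
  proof -
    have "2 * v < R" using tree_bound[OF X[OF that(1)] that(2)] by (simp add: R_def)
    then show ?thesis by (simp add: H_def)
  qed
  have "tree B (e # es) Y" using D X by (auto simp: Y_def R_def intro!: exI[of _ D] exI[of _ X])
  moreover have "\<forall>w\<in>Y. tree B fs (H w)" using H G by (auto simp: Y_def)
  moreover have "A = (\<Union>w\<in>Y. (\<lambda>x. w * S + x) ` H w)"
  proof -
    have "(\<lambda>x. d * (R * S) + x) ` F d = (\<Union>v\<in>X d. (\<lambda>x. (d * R + v) * S + x) ` H (d * R + v))"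
      if "d \<in> D" for d
      unfolding F[OF that] image_UN image_image
      by (intro SUP_cong refl) (simp add: H[OF that] distrib_right mult.assoc add.assoc)
    then have "A = (\<Union>d\<in>D. \<Union>v\<in>X d. (\<lambda>x. (d * R + v) * S + x) ` H (d * R + v))"
      unfolding A by (intro SUP_cong refl)
    then show ?thesis unfolding Y_def by blast
  qed
  ultimately show ?case unfolding S_def by blast
qed

lemma tree_exists: "(\<And>e. e \<in> set es \<Longrightarrow> 2 * 2 ^ e \<le> B) \<Longrightarrow> \<exists>A. tree B es A"
proof (induction es)
  case (Cons e es)
  then obtain A where "tree B es A" by auto
  moreover have "2 * 2 ^ e \<le> B" using Cons.prems by simp
  ultimately have "tree B (e # es) (\<Union>d\<in>{..<2 ^ e}. (\<lambda>x. d * B ^ length es + x) ` A)"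
    by (auto intro!: exI[of _ "{..<2 ^ e}"] exI[of _ "\<lambda>_. A"])
  then show ?case by blast
qed auto

text \<open>Each level may cost a density of \<open>1 / 2 ^ s\<close>, so a density above
  \<open>length es / 2 ^ s\<close> lasts down to the leaves, while the branching drops from
  \<open>2 ^ (s + e)\<close> to \<open>2 ^ e\<close>.\<close>

lemma tree_thin:
  "tree B (map ((+) s) es) A \<Longrightarrow> S \<subseteq> A \<Longrightarrow> length es * card A < 2 ^ s * card S \<Longrightarrow>
     \<exists>A'\<subseteq>S. tree B es A'"
proof (induction es arbitrary: A S)
  case Nil
  then show ?case by (auto simp: subset_singleton_iff)
next
  case (Cons e es)
  define R where "R = B ^ length es"
  define h where "h = length es"
  define N where "N = (2::nat) ^ sum_list (map ((+) s) es)"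
  from Cons.prems(1) obtain D F where D: "D \<subseteq> {d. 2 * d < B}" "finite D" "card D = 2 ^ (s + e)"
    and F: "\<And>d. d \<in> D \<Longrightarrow> tree B (map ((+) s) es) (F d)"
    and A: "A = (\<Union>d\<in>D. (\<lambda>x. d * R + x) ` F d)" by (auto simp: R_def)
  have cF: "finite (F d)" "card (F d) = N" if "d \<in> D" for d
    using tree_card[OF F[OF that]] by (auto simp: N_def)
  define T where "T = (\<lambda>d. {x \<in> F d. d * R + x \<in> S})"
  \<comment> \<open>\<open>G\<close> collects the digits below which \<open>S\<close> keeps density
    above \<open>h / 2 ^ s\<close>, as the induction hypothesis requires.\<close>
  define G where "G = {d \<in> D. h * N < 2 ^ s * card (T d)}"
  have cA: "card A = 2 ^ (s + e) * N"
    using tree_card[OF Cons.prems(1)] by (simp add: N_def power_add)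
  have S: "S = (\<Union>d\<in>D. (\<lambda>x. d * R + x) ` T d)"
  proof
    show "S \<subseteq> (\<Union>d\<in>D. (\<lambda>x. d * R + x) ` T d)"
    proof
      fix x assume "x \<in> S"
      with Cons.prems(2) obtain d y where "d \<in> D" "y \<in> F d" "x = d * R + y" unfolding A by blast
      with \<open>x \<in> S\<close> show "x \<in> (\<Union>d\<in>D. (\<lambda>x. d * R + x) ` T d)" by (auto simp: T_def)
    qed
  qed (auto simp: T_def)
  have finT: "finite (T d)" and cT: "card (T d) \<le> N" if "d \<in> D" for d
    using cF[OF that] card_mono[of "F d" "T d"] by (auto simp: T_def)
  have "card S \<le> (\<Sum>d\<in>D. card ((\<lambda>x. d * R + x) ` T d))"
    unfolding S using D(2) by (rule card_UN_le)
  also have "\<dots> = (\<Sum>d\<in>D. card (T d))" by (simp add: card_image)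
  finally have cS: "card S \<le> (\<Sum>d\<in>D. card (T d))" .
  \<comment> \<open>Fewer than \<open>2 ^ e\<close> good digits are less than a share
    \<open>1 / 2 ^ s\<close> of \<open>D\<close>; even if \<open>S\<close> filled them completely,
    its density would be at most \<open>(h + 1) / 2 ^ s\<close>.\<close>
  have "2 ^ e \<le> card G"
  proof (rule ccontr)
    assume "\<not> ?thesis"
    then have G: "card G \<le> 2 ^ e" by simp
    have GD: "G \<subseteq> D" by (auto simp: G_def)
    have "2 ^ s * card S \<le> (\<Sum>d\<in>D. 2 ^ s * card (T d))"
      using cS by (simp flip: sum_distrib_left)
    also have "\<dots> \<le> (\<Sum>d\<in>D. h * N + (if d \<in> G then 2 ^ s * N else 0))"
      using cT by (intro sum_mono) (auto simp: G_def intro: order_trans trans_le_add2)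
    also have "\<dots> = 2 ^ (s + e) * (h * N) + card G * (2 ^ s * N)"
      using D(2,3) GD by (simp add: sum.distrib sum.If_cases Int_absorb1)
    also have "\<dots> \<le> 2 ^ (s + e) * (h * N) + 2 ^ e * (2 ^ s * N)"
      using G by simp
    also have "\<dots> = length (e # es) * card A"
      by (simp add: cA h_def algebra_simps power_add)
    finally show False using Cons.prems(3) by simp
  qed
  then obtain D' where D': "D' \<subseteq> G" "card D' = 2 ^ e" "finite D'"
    using obtain_subset_with_card_n by metis
  have "\<exists>A'\<subseteq>T d. tree B es A'" if "d \<in> D'" for d
  proof (rule Cons.IH[OF F])
    show "d \<in> D" "T d \<subseteq> F d" using that D' by (auto simp: G_def T_def)
    show "length es * card (F d) < 2 ^ s * card (T d)"
      using that D' cF by (auto simp: G_def h_def)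
  qed
  then obtain F' where F': "\<And>d. d \<in> D' \<Longrightarrow> F' d \<subseteq> T d \<and> tree B es (F' d)" by metis
  have "tree B (e # es) (\<Union>d\<in>D'. (\<lambda>x. d * R + x) ` F' d)"
    using D' D(1) F' by (auto simp: R_def G_def intro!: exI[of _ D'] exI[of _ F'])
  moreover have "(\<Union>d\<in>D'. (\<lambda>x. d * R + x) ` F' d) \<subseteq> S"
    using F' by (fastforce simp: T_def)
  ultimately show ?case by blast
qed

section \<open>Double counting in a product\<close>

text \<open>A class that is sparse on every line in its own direction is sparse in the whole product, so
  the classes cannot all be sparse on their lines.\<close>

lemma dense_class_on_line:
  fixes F :: "'a \<Rightarrow> 'b set" and \<Gamma> :: "('a \<Rightarrow> 'b) \<Rightarrow> 'c"
  assumes X: "finite X" and F: "\<And>v. v \<in> X \<Longrightarrow> finite (F v) \<and> F v \<noteq> {}"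
    and T: "finite T" "T \<noteq> {}" and \<Gamma>: "\<And>\<phi>. \<phi> \<in> PiE X F \<Longrightarrow> \<Gamma> \<phi> \<in> T"
    and dir: "\<And>\<tau>. \<tau> \<in> T \<Longrightarrow> dir \<tau> \<in> X"
  shows "\<exists>\<phi>\<in>PiE X F. \<exists>\<tau>\<in>T.
    card (F (dir \<tau>)) \<le> card T * card {y \<in> F (dir \<tau>). \<Gamma> (\<phi>(dir \<tau> := y)) = \<tau>}"
proof (rule ccontr)
  assume neg: "\<not> ?thesis"
  let ?P = "PiE X F"
  have finP: "finite ?P" using X F by (intro finite_PiE) auto
  have "card T * card {\<phi> \<in> ?P. \<Gamma> \<phi> = \<tau>} < card ?P" if \<tau>: "\<tau> \<in> T" for \<tau>
  proof -
    define v where "v = dir \<tau>"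
    define Q where "Q = PiE (X - {v}) F"
    have v: "v \<in> X" "insert v (X - {v}) = X" using dir \<tau> by (auto simp: v_def)
    have finQ: "finite Q" unfolding Q_def using X F by (intro finite_PiE) auto
    have neQ: "Q \<noteq> {}" unfolding Q_def using F by (subst PiE_eq_empty_iff) blast
    \<comment> \<open>The product splits into lines in direction \<open>v\<close>, one for each
      point \<open>\<psi>\<close> of \<open>Q\<close>.\<close>
    have Peq: "?P = (\<lambda>(y, \<psi>). \<psi>(v := y)) ` (F v \<times> Q)"
      using PiE_insert_eq[of v "X - {v}" F] v(2) by (simp add: Q_def)
    have inj: "inj_on (\<lambda>(y, \<psi>). \<psi>(v := y)) (F v \<times> Q)"
      unfolding Q_def by (rule inj_combinator) simp
    have line: "card T * card {y \<in> F v. \<Gamma> (\<psi>(v := y)) = \<tau>} < card (F v)" if "\<psi> \<in> Q" for \<psi>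
    proof -
      obtain y where y: "y \<in> F v" using F v(1) by blast
      then have "\<psi>(v := y) \<in> ?P" using that Peq by auto
      with neg \<tau> have "\<not> card (F v) \<le> card T * card {y' \<in> F v. \<Gamma> ((\<psi>(v := y))(v := y')) = \<tau>}"
        unfolding v_def by blast
      then show ?thesis by simp
    qed
    have "{\<phi> \<in> ?P. \<Gamma> \<phi> = \<tau>} =
        (\<lambda>(y, \<psi>). \<psi>(v := y)) ` {(y, \<psi>) \<in> F v \<times> Q. \<Gamma> (\<psi>(v := y)) = \<tau>}"
      unfolding Peq by auto
    then have "card {\<phi> \<in> ?P. \<Gamma> \<phi> = \<tau>} = card {(y, \<psi>) \<in> F v \<times> Q. \<Gamma> (\<psi>(v := y)) = \<tau>}"
      using inj by (simp only:) (intro card_image, auto intro: inj_on_subset)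
    also have "{(y, \<psi>) \<in> F v \<times> Q. \<Gamma> (\<psi>(v := y)) = \<tau>} =
        prod.swap ` (SIGMA \<psi>:Q. {y \<in> F v. \<Gamma> (\<psi>(v := y)) = \<tau>})" by auto
    also have "card \<dots> = (\<Sum>\<psi>\<in>Q. card {y \<in> F v. \<Gamma> (\<psi>(v := y)) = \<tau>})"
      using finQ F v(1) by (simp add: card_image)
    finally have "card T * card {\<phi> \<in> ?P. \<Gamma> \<phi> = \<tau>} =
        (\<Sum>\<psi>\<in>Q. card T * card {y \<in> F v. \<Gamma> (\<psi>(v := y)) = \<tau>})" by (simp add: sum_distrib_left)
    also have "\<dots> < (\<Sum>\<psi>\<in>Q. card (F v))"
      using finQ neQ line by (intro sum_strict_mono) auto
    also have "\<dots> = card ?P" unfolding Peq using inj by (simp add: card_image card_cartesian_product)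
    finally show ?thesis .
  qed
  then have "(\<Sum>\<tau>\<in>T. card T * card {\<phi> \<in> ?P. \<Gamma> \<phi> = \<tau>}) < (\<Sum>\<tau>\<in>T. card ?P)"
    using T by (intro sum_strict_mono) auto
  moreover have "(\<Sum>\<tau>\<in>T. card {\<phi> \<in> ?P. \<Gamma> \<phi> = \<tau>}) = card ?P"
    using card_UN_disjoint[of T "\<lambda>\<tau>. {\<phi> \<in> ?P. \<Gamma> \<phi> = \<tau>}"] T(1) finP \<Gamma>
    by (subst card_UN_disjoint[symmetric]) (auto intro!: arg_cong[of _ _ card])
  ultimately show False by (simp flip: sum_distrib_left)
qed

section \<open>Monochromatic sequences with ordered differences\<close>

text \<open>\<open>d\<close> counts differences, so there are \<open>d + 1\<close> elements. A rank
  function encodes the order because deleting an index then merely reindexes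
  \<open>\<rho>\<close>.\<close>

definition ordered_clique ::
  "(nat \<Rightarrow> nat \<Rightarrow> 'a) \<Rightarrow> (nat \<Rightarrow> nat) \<Rightarrow> nat \<Rightarrow> 'a \<Rightarrow> (nat \<Rightarrow> nat) \<Rightarrow> bool" where
  "ordered_clique g \<rho> d k a \<longleftrightarrow> (\<forall>i<d. a i < a (Suc i)) \<and>
     (\<forall>i j. i < j \<and> j \<le> d \<longrightarrow> g (a i) (a j) = k) \<and>
     (\<forall>i<d. \<forall>j<d. \<rho> i < \<rho> j \<longrightarrow> a (Suc i) - a i < a (Suc j) - a j)"

lemma ordered_clique_cong:
  "(\<And>i. i \<le> d \<Longrightarrow> a i = a' i) \<Longrightarrow> ordered_clique g \<rho> d k a \<longleftrightarrow> ordered_clique g \<rho> d k a'"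
  unfolding ordered_clique_def by (simp add: Suc_leI cong: conj_cong)

lemma ordered_clique_strict_mono:
  assumes "ordered_clique g \<rho> d k a" "i < j" "j \<le> d"
  shows "a i < a j"
  using assms(2,3)
proof (induction j)
  case (Suc j)
  then show ?case using assms(1)
    by (cases "i = j") (auto simp: ordered_clique_def intro: less_trans)
qed simp

text \<open>Distinct top strings contribute at least \<open>R\<close>, and the bottom strings
  correct this by less than \<open>R / 2\<close>. Two strings with the same top differ by less than
  \<open>R / 2\<close>, hence by less than any such pair.\<close>

lemma digit_diff_gt:
  fixes A A' R x x' :: nat
  assumes "A < A'" "2 * x < R" "2 * x' < R"
  shows "A * R + x < A' * R + x'" "R < 2 * ((A' * R + x') - (A * R + x))"
proof -
  from assms(1) obtain D where A': "A' = A + Suc D" using less_iff_Suc_add by auto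
  have "R * Suc D \<ge> R" by simp
  then show "A * R + x < A' * R + x'" "R < 2 * ((A' * R + x') - (A * R + x))"
    using assms(2,3) unfolding A' by (auto simp: algebra_simps)
qed

text \<open>The top differences, scaled by \<open>R\<close>, are at least \<open>R\<close> apart;
  the corrections from the two pairs of bottom strings are each below \<open>R / 2\<close>.\<close>

lemma digit_diff_less:
  fixes A A' C C' R x x' z z' :: nat
  assumes "A < A'" "C < C'" "A' - A < C' - C"
    "2 * x < R" "2 * x' < R" "2 * z < R" "2 * z' < R"
  shows "(A' * R + x') - (A * R + x) < (C' * R + z') - (C * R + z)"
proof -
  obtain D where A': "A' = A + D" using assms(1) less_imp_add_positive by blast
  obtain E where C': "C' = C + E" using assms(2) less_imp_add_positive by blast
  have "Suc D \<le> E" using assms(3) by (simp add: A' C')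
  then have "Suc D * R \<le> E * R" by (rule mult_right_mono) simp
  then show ?thesis using assms(4-7) by (auto simp: A' C' algebra_simps)
qed

text \<open>The element \<open>a p\<close> is doubled: it is completed by \<open>y\<close> and by \<open>y'\<close>, the others by \<open>u\<close>.\<close>

lemma ordered_clique_split:
  assumes top: "\<And>z. z \<in> {y, y'} \<Longrightarrow>
      ordered_clique (\<lambda>v w. g (v * R + (u(a p := z)) v) (w * R + (u(a p := z)) w))
        (\<lambda>i. \<rho> (if i < p then i else Suc i)) d k a"
    and p: "p \<le> d" "\<And>i. i \<le> d \<Longrightarrow> \<rho> p \<le> \<rho> i"
    and y: "y < y'" "2 * y' < R" "g (a p * R + y) (a p * R + y') = k"
    and u: "\<And>i. i \<le> d \<Longrightarrow> i \<noteq> p \<Longrightarrow> 2 * u (a i) < R"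
    and b: "b = (\<lambda>i. if i \<le> p then a i * R + (u(a p := y)) (a i)
      else a (i - 1) * R + (u(a p := y')) (a (i - 1)))"
  shows "ordered_clique g \<rho> (Suc d) k b"
proof -
  \<comment> \<open>\<open>e\<close> merges the indices \<open>p\<close> and \<open>Suc p\<close> of
    \<open>b\<close>, which share the top string \<open>a p\<close>; \<open>q\<close> gives the
    bottom strings.\<close>
  define e where "e = (\<lambda>i. if i \<le> p then i else i - 1)"
  define q where "q = (\<lambda>i. if i \<le> p then (u(a p := y)) (a i) else (u(a p := y')) (a (i - 1)))"
  have b': "b i = a (e i) * R + q i" for i by (simp add: b e_def q_def)
  note top1 = top[of y, simplified] and top2 = top[of y', simplified]
  have a_less: "a i < a j" if "i < j" "j \<le> d" for i j
    using ordered_clique_strict_mono[OF top1 that] .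
  have a_inj: "a i = a j \<longleftrightarrow> i = j" if "i \<le> d" "j \<le> d" for i j
    using a_less[of i j] a_less[of j i] that by (cases i j rule: linorder_cases) auto
  have q: "2 * q i < R" if "i \<le> Suc d" for i
    using that y u[of i] u[of "i - 1"] p(1) a_inj[of i p] a_inj[of "i - 1" p]
    by (auto simp: q_def)
  \<comment> \<open>For \<open>i \<noteq> p\<close> the difference of \<open>b\<close> at
    \<open>i\<close> lies over the difference of \<open>a\<close> at \<open>e i\<close>, and the
    reindexing that skips \<open>p\<close> undoes \<open>e\<close>.\<close>
  have step: "e (Suc i) = Suc (e i)" "e i < d" "(if e i < p then e i else Suc (e i)) = i"
    if "i < Suc d" "i \<noteq> p" for i
    using that p(1) by (auto simp: e_def)
  have bp: "b p = a p * R + y" "b (Suc p) = a p * R + y'" by (auto simp: b)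
  have less: "b i < b (Suc i)" if "i < Suc d" for i
  proof (cases "i = p")
    case True
    then show ?thesis using y(1) bp by simp
  next
    case False
    then show ?thesis unfolding b' using step[OF that] a_less q[of i] q[of "Suc i"] that
      by (intro digit_diff_gt) auto
  qed
  have col1: "g (a i * R + (u(a p := y)) (a i)) (a j * R + (u(a p := y)) (a j)) = k"
    and col2: "g (a i * R + (u(a p := y')) (a i)) (a j * R + (u(a p := y')) (a j)) = k"
    if "i < j" "j \<le> d" for i j
    using top1 top2 that by (simp_all add: ordered_clique_def)
  have top_ord: "a (Suc i) - a i < a (Suc j) - a j"
    if "i < d" "j < d" "\<rho> (if i < p then i else Suc i) < \<rho> (if j < p then j else Suc j)" for i j
    using top1 that unfolding ordered_clique_def by blast
  have col: "g (b i) (b j) = k" if "i < j" "j \<le> Suc d" for i j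
  proof -
    \<comment> \<open>Only the pair \<open>p\<close>, \<open>Suc p\<close> involves both completions
      of \<open>a p\<close>; every other pair lies in the clique for \<open>y\<close> or in that for
      \<open>y'\<close>.\<close>
    consider "j \<le> p" | "i \<le> p" "p < j" "i = p \<longrightarrow> j \<noteq> Suc p" | "i = p" "j = Suc p" | "p < i"
      using that by linarith
    then show ?thesis
    proof cases
      case 1
      then show ?thesis using col1[of i j] that p(1) by (simp add: b)
    next
      case 2
      show ?thesis
      proof (cases "i = p")
        case True
        have "a (j - 1) \<noteq> a p" "p < j - 1" "j - 1 \<le> d" using a_inj[of "j - 1" p] 2 that p(1) True by auto
        then show ?thesis using col1[of p "j - 1"] True 2 by (simp add: b)
      next
        case False
        then have "a i \<noteq> a p" "i < j - 1" "j - 1 \<le> d" using a_inj[of i p] 2 that p(1) by auto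
        then show ?thesis using col2[of i "j - 1"] 2 by (simp add: b)
      qed
    next
      case 3
      then show ?thesis using bp y(3) by simp
    next
      case 4
      then have "i - 1 < j - 1" "j - 1 \<le> d" using that by auto
      then show ?thesis using col2[of "i - 1" "j - 1"] 4 that by (simp add: b)
    qed
  qed
  have ord: "b (Suc i) - b i < b (Suc j) - b j"
    if ij: "i < Suc d" "j < Suc d" "\<rho> i < \<rho> j" for i j
  proof -
    \<comment> \<open>Nothing has to be smaller than the difference at \<open>p\<close>, whose rank
      is least.\<close>
    have jp: "j \<noteq> p" using p(2)[of i] ij by auto
    show ?thesis
    proof (cases "i = p")
      case True
      have "b (Suc i) - b i = y' - y" using True bp by simp
      moreover have "R < 2 * (b (Suc j) - b j)"
        unfolding b' using step[OF ij(2) jp] a_less q[of j] q[of "Suc j"] ij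
        by (intro digit_diff_gt) auto
      ultimately show ?thesis using y(1,2) by linarith
    next
      case False
      note si = step[OF ij(1) False] and sj = step[OF ij(2) jp]
      have "a (Suc (e i)) - a (e i) < a (Suc (e j)) - a (e j)"
        using top_ord[of "e i" "e j"] unfolding si(3) sj(3) using si(2) sj(2) ij(3) by blast
      then show ?thesis
        unfolding b' si(1) sj(1) using a_less si(2) sj(2) q ij
        by (intro digit_diff_less) auto
    qed
  qed
  show ?thesis unfolding ordered_clique_def using less col ord by blast
qed

section \<open>The induction on differences and colours\<close>

text \<open>The bottom block is enlarged so that a subset of density \<open>1 / Q\<close> still contains a tree
  of the original shape (lemma \<open>tree_thin\<close>), where
  \<open>Q = Suc c * (2 ^ sum_list (exps d (Suc c))) ^ Suc d\<close> bounds the number of candidates \<open>(V, k)\<close>.\<close>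

fun exps :: "nat \<Rightarrow> nat \<Rightarrow> nat list" where
  "exps 0 c = []"
| "exps (Suc d) 0 = [1]"
| "exps (Suc d) (Suc c) = exps d (Suc c) @
     map ((+) (length (exps (Suc d) c) + Suc c + Suc d * sum_list (exps d (Suc c)))) (exps (Suc d) c)"

text \<open>\<open>C\<close>, \<open>g\<close> and \<open>\<rho>\<close> vary because the induction
  recolours and reorders on the top strings and drops a colour on the bottom strings.
  \<open>0 < d + c\<close> provides a colour when \<open>d = 0\<close>.\<close>

theorem ordered_clique_in_tree:
  "tree B (exps d c) A \<Longrightarrow> finite C \<Longrightarrow> card C = c \<Longrightarrow> 0 < d + c \<Longrightarrow>
     (\<And>x y. x \<in> A \<Longrightarrow> y \<in> A \<Longrightarrow> x < y \<Longrightarrow> g x y \<in> C) \<Longrightarrow>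
     \<exists>a k. k \<in> C \<and> (\<forall>i\<le>d. a i \<in> A) \<and> ordered_clique g \<rho> d k a"
proof (induction d c arbitrary: A C g \<rho> rule: exps.induct)
  case (1 c)
  then obtain k where "k \<in> C" by force
  moreover have "A = {0}" using 1 by simp
  ultimately show ?case by (auto simp: ordered_clique_def intro!: exI[of _ "\<lambda>_. 0"])
next
  case (2 d)
  \<comment> \<open>The exponent \<open>1\<close> gives two leaves, whose pair would need a colour
    from the empty \<open>C\<close>.\<close>
  then have "card A = 2" "C = {}" using tree_card[of B "[1]" A] by auto
  then obtain x y where "x \<in> A" "y \<in> A" "x < y"
    by (metis card_2_iff insertI1 insertI2 linorder_neqE_nat)
  then show ?case using 2(5) \<open>C = {}\<close> by blast
next
  case (3 d c)
  define es where "es = exps d (Suc c)"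
  define fs where "fs = exps (Suc d) c"
  define s where "s = length fs + Suc c + Suc d * sum_list es"
  define R where "R = B ^ length fs"
  have "tree B (es @ map ((+) s) fs) A"
    using "3.prems"(1) by (simp add: es_def fs_def s_def)
  from tree_append[OF this] obtain X F where X: "tree B es X"
    and F: "\<And>v. v \<in> X \<Longrightarrow> tree B (map ((+) s) fs) (F v)"
    and A: "A = (\<Union>v\<in>X. (\<lambda>x. v * R + x) ` F v)" by (auto simp: R_def)
  have inA: "v * R + x \<in> A" if "v \<in> X" "x \<in> F v" for v x
    using that unfolding A by blast
  have FR: "2 * x < R" if "v \<in> X" "x \<in> F v" for v x
    using tree_bound[OF F[OF that(1)] that(2)] by (simp add: R_def)
  \<comment> \<open>\<open>p\<close> is the place of a difference of least rank;
    \<open>\<rho>'\<close> is the order with that place removed.\<close>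
  obtain p where p: "p \<le> d" "\<And>i. i \<le> d \<Longrightarrow> \<rho> p \<le> \<rho> i"
    using ex_min_if_finite[of "\<rho> ` {..d}"]
    by (metis (no_types, lifting) atMost_iff empty_iff finite_atMost finite_imageI image_iff
        imageI linorder_not_less le0)
  define \<rho>' where "\<rho>' = (\<lambda>i. \<rho> (if i < p then i else Suc i))"
  define g' where "g' = (\<lambda>\<phi> v w. g (v * R + \<phi> v) (w * R + \<phi> w))"
  \<comment> \<open>Extensional functions keep the set of candidates finite, which is why
    \<open>a\<close> is restricted to \<open>{..d}\<close> below.\<close>
  define T where "T = ({..d} \<rightarrow>\<^sub>E X) \<times> C"
  have "\<exists>\<tau>\<in>T. ordered_clique (g' \<phi>) \<rho>' d (snd \<tau>) (fst \<tau>)" if \<phi>: "\<phi> \<in> PiE X F" for \<phi>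
  proof -
    have "\<exists>a k. k \<in> C \<and> (\<forall>i\<le>d. a i \<in> X) \<and> ordered_clique (g' \<phi>) \<rho>' d k a"
    proof (rule "3.IH"(1))
      show "g' \<phi> v w \<in> C" if "v \<in> X" "w \<in> X" "v < w" for v w
      proof -
        have "\<phi> v \<in> F v" "\<phi> w \<in> F w" using \<phi> that by auto
        then show ?thesis unfolding g'_def using that inA FR
          by (intro "3.prems"(5) digit_diff_gt(1)) auto
      qed
    qed (use X "3.prems" in \<open>auto simp: es_def\<close>)
    then obtain a k where ak: "k \<in> C" "\<forall>i\<le>d. a i \<in> X" "ordered_clique (g' \<phi>) \<rho>' d k a" by blast
    have "ordered_clique (g' \<phi>) \<rho>' d k (restrict a {..d})"
      using ak(3) by (subst ordered_clique_cong[of d _ a]) auto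
    then show ?thesis using ak(1,2) by (intro bexI[of _ "(restrict a {..d}, k)"]) (auto simp: T_def)
  qed
  then obtain \<Gamma> where \<Gamma>: "\<And>\<phi>. \<phi> \<in> PiE X F \<Longrightarrow> \<Gamma> \<phi> \<in> T"
    "\<And>\<phi>. \<phi> \<in> PiE X F \<Longrightarrow> ordered_clique (g' \<phi>) \<rho>' d (snd (\<Gamma> \<phi>)) (fst (\<Gamma> \<phi>))" by metis
  have cX: "finite X" "card X = 2 ^ sum_list es" using tree_card[OF X] by auto
  have "card ({..d} \<rightarrow>\<^sub>E X) = 2 ^ (Suc d * sum_list es)"
    by (simp add: card_PiE cX(2) flip: power_mult power_Suc add: mult.commute)
  then have cT: "card T = 2 ^ (Suc d * sum_list es) * Suc c"
    using "3.prems"(3) by (simp only: T_def card_cartesian_product)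
  have finT: "finite T" unfolding T_def using cX(1) "3.prems"(2)
    by (intro finite_cartesian_product finite_PiE) auto
  have "T \<noteq> {}" using cT by force
  moreover have "fst \<tau> p \<in> X" if "\<tau> \<in> T" for \<tau> using that p(1) by (auto simp: T_def)
  \<comment> \<open>The direction assigned to a candidate is its element at index \<open>p\<close>,
    the one to be doubled.\<close>
  ultimately obtain \<phi> \<tau> where \<phi>: "\<phi> \<in> PiE X F" and \<tau>: "\<tau> \<in> T"
    and dense: "card (F (fst \<tau> p)) \<le> card T * card {y \<in> F (fst \<tau> p). \<Gamma> (\<phi>(fst \<tau> p := y)) = \<tau>}"
    using dense_class_on_line[of X F T \<Gamma> "\<lambda>\<tau>. fst \<tau> p"] cX(1) finT F \<Gamma>(1)
      tree_finite tree_nonempty by (metis (lifting))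
  obtain a k where ak: "\<tau> = (a, k)" by force
  have a: "a i \<in> X" if "i \<le> d" for i using \<tau> that by (auto simp: T_def ak)
  have k: "k \<in> C" using \<tau> by (simp add: T_def ak)
  define v where "v = a p"
  have v: "v \<in> X" using a p(1) by (simp add: v_def)
  define I where "I = {y \<in> F v. \<Gamma> (\<phi>(v := y)) = \<tau>}"
  \<comment> \<open>The three summands of \<open>s\<close> pay, in order, for the factor
    \<open>length fs\<close> in \<open>tree_thin\<close>, for the choice of the colour, and for the
    choice of the \<open>d + 1\<close> elements of a candidate.\<close>
  have "length fs * card (F v) < 2 ^ s * card I"
  proof -
    have "0 < card (F v)" using F[OF v] tree_finite tree_nonempty by (metis card_gt_0_iff)
    then have "length fs * card (F v) < Suc (length fs) * card (F v)" by simp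
    also have "\<dots> \<le> 2 ^ length fs * card (F v)" by (intro mult_right_mono) (auto simp: Suc_leI)
    also have "\<dots> \<le> 2 ^ length fs * (card T * card I)"
      using dense by (simp add: ak v_def I_def)
    also have "\<dots> \<le> 2 ^ length fs * (2 ^ (Suc d * sum_list es) * 2 ^ Suc c * card I)"
      unfolding cT by (intro mult_left_mono mult_right_mono) (simp_all add: Suc_leI less_exp del: power_Suc)
    also have "\<dots> = 2 ^ s * card I" by (simp add: s_def power_add)
    finally show ?thesis .
  qed
  then obtain I' where I': "I' \<subseteq> I" "tree B fs I'"
    using tree_thin[OF F[OF v], of I] by (auto simp: I_def)
  have clique: "ordered_clique (g' (\<phi>(v := y))) \<rho>' d k a" if "y \<in> I'" for y
  proof -
    have y: "y \<in> F v" "\<Gamma> (\<phi>(v := y)) = \<tau>" using that I'(1) by (auto simp: I_def)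
    then have "\<phi>(v := y) \<in> PiE X F" using \<phi> v by (auto simp: PiE_iff extensional_def)
    from \<Gamma>(2)[OF this] show ?thesis by (simp add: y ak)
  qed
  show ?case
  proof (cases "\<exists>y\<in>I'. \<exists>y'\<in>I'. y < y' \<and> g (v * R + y) (v * R + y') = k")
    case True
    then obtain y y' where y: "y \<in> I'" "y' \<in> I'" "y < y'" "g (v * R + y) (v * R + y') = k" by blast
    have yF: "y \<in> F v" "y' \<in> F v" using y I'(1) by (auto simp: I_def)
    define b where "b = (\<lambda>i. if i \<le> p then a i * R + (\<phi>(a p := y)) (a i)
      else a (i - 1) * R + (\<phi>(a p := y')) (a (i - 1)))"
    have "ordered_clique g \<rho> (Suc d) k b"
    proof (rule ordered_clique_split[where u = \<phi> and a = a and R = R and p = p and \<rho> = \<rho>, OF _ p y(3) _ _ _ b_def])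
      show "2 * \<phi> (a i) < R" if "i \<le> d" "i \<noteq> p" for i
        using FR[OF a[OF that(1)]] \<phi> a[OF that(1)] by (auto simp: PiE_iff)
      show "2 * y' < R" using FR[OF v yF(2)] .
    qed (use clique y in \<open>auto simp: g'_def \<rho>'_def v_def\<close>)
    moreover have "b i \<in> A" if "i \<le> Suc d" for i
    proof (cases "i \<le> p")
      case True
      then have "a i \<in> X" using a p(1) by simp
      then show ?thesis using True \<phi> yF unfolding b_def by (auto intro!: inA simp: v_def PiE_iff)
    next
      case False
      then have "a (i - 1) \<in> X" using a that by simp
      then show ?thesis using False \<phi> yF unfolding b_def by (auto intro!: inA simp: v_def PiE_iff)
    qed
    ultimately show ?thesis using k by blast
  next
    case False
    \<comment> \<open>The colour \<open>k\<close> does not occur on \<open>I'\<close>, and prefixing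
      the common string \<open>v\<close> leaves all differences unchanged.\<close>
    have "\<exists>a' k'. k' \<in> C - {k} \<and> (\<forall>i\<le>Suc d. a' i \<in> I') \<and>
        ordered_clique (\<lambda>y y'. g (v * R + y) (v * R + y')) \<rho> (Suc d) k' a'"
    proof (rule "3.IH"(2))
      show "g (v * R + y) (v * R + y') \<in> C - {k}" if "y \<in> I'" "y' \<in> I'" "y < y'" for y y'
      proof -
        have "y \<in> F v" "y' \<in> F v" using that(1,2) I'(1) by (auto simp: I_def)
        then have "g (v * R + y) (v * R + y') \<in> C"
          using that(3) by (intro "3.prems"(5) inA[OF v]) auto
        then show ?thesis using False that by blast
      qed
    qed (use I' k "3.prems" in \<open>auto simp: fs_def\<close>)
    then obtain a' k' where a': "k' \<in> C" "\<forall>i\<le>Suc d. a' i \<in> I'"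
      "ordered_clique (\<lambda>y y'. g (v * R + y) (v * R + y')) \<rho> (Suc d) k' a'" by blast
    then have "ordered_clique g \<rho> (Suc d) k' (\<lambda>i. v * R + a' i)"
      by (simp add: ordered_clique_def)
    moreover have "\<forall>i\<le>Suc d. v * R + a' i \<in> A" using a'(2) I'(1) inA[OF v] by (auto simp: I_def)
    ultimately show ?thesis using a'(1)
      by (intro exI[of _ "\<lambda>i. v * R + a' i"] exI[of _ k'] conjI)
  qed
qed

section \<open>Bounds on the number of digits and on the exponents\<close>

text \<open>The lengths obey a Pascal-type recursion, and
  \<open>Suc d ^ Suc c = d * Suc d ^ c + Suc d ^ c\<close> leaves room for both blocks.\<close>

lemma length_exps: "length (exps d c) \<le> d ^ c"
proof (induction d c rule: exps.induct)
  case (3 d c)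
  have "d ^ Suc c \<le> d * Suc d ^ c" by (simp add: power_mono)
  then have "d ^ Suc c + Suc d ^ c \<le> Suc d ^ Suc c" by simp
  moreover have "length (exps (Suc d) (Suc c)) \<le> d ^ Suc c + Suc d ^ c"
    unfolding exps.simps length_append length_map by (rule add_mono[OF 3(1,2)])
  ultimately show ?case by linarith
qed auto

text \<open>In the recursive case the sum unfolds into three terms, each at most
  \<open>b ^ Suc c * P\<close>. Then \<open>3 \<le> b\<close> absorbs the factor three, and the
  exponents match: \<open>1 + (c + 1) + (c + 2) * d = (c + 2) * (d + 1)\<close>.\<close>

lemma Suc_sum_exps: "d + 2 \<le> b \<Longrightarrow> Suc (sum_list (exps d c)) \<le> b ^ ((c + 1) * d)"
proof (induction d c rule: exps.induct)
  case (1 c)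
  then show ?case by simp
next
  case (2 d)
  have "b \<le> b ^ Suc d" using 2 by (intro self_le_power) auto
  moreover have "3 \<le> b" using 2 by simp
  ultimately have "2 \<le> b ^ Suc d" by linarith
  then show ?case by simp
next
  case (3 d c)
  define P where "P = b ^ ((c + 2) * d)"
  define h where "h = length (exps (Suc d) c)"
  define x where "x = sum_list (exps d (Suc c))"
  define y where "y = sum_list (exps (Suc d) c)"
  have x: "Suc x \<le> P" and y: "Suc y \<le> b ^ (Suc c * Suc d)"
    using 3 by (simp_all add: P_def x_def y_def)
  have h: "h \<le> Suc d ^ c" unfolding h_def by (rule length_exps)
  have b: "3 \<le> b" "Suc d \<le> b" "Suc (Suc d) \<le> b" using "3.prems" by auto
  have P: "1 \<le> P" using x by simp
  \<comment> \<open>This is the coefficient of \<open>x\<close>: one from the top block, and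
    \<open>Suc d\<close> from the shift of each of the \<open>h\<close> bottom digits.\<close>
  have "Suc (h * Suc d) \<le> Suc (Suc d ^ c * Suc d)" using h by (intro Suc_leI le_imp_less_Suc mult_right_mono) auto
  also have "\<dots> \<le> Suc (Suc d) ^ Suc c"
  proof -
    have "Suc d ^ c * Suc d \<le> Suc (Suc d) ^ c * Suc d" by (intro mult_right_mono power_mono) auto
    moreover have "1 \<le> Suc (Suc d) ^ c" by simp
    moreover have "Suc (Suc d) ^ Suc c = Suc (Suc d) ^ c + Suc (Suc d) ^ c * Suc d"
      by (simp add: algebra_simps)
    ultimately show ?thesis by linarith
  qed
  also have "\<dots> \<le> b ^ Suc c" using b by (intro power_mono) auto
  finally have 1: "x * Suc (h * Suc d) \<le> b ^ Suc c * P"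
    using x by (subst mult.commute) (intro mult_mono; simp)
  have "b ^ (Suc c * Suc d) \<le> b ^ (Suc c + (c + 2) * d)" using b by (intro power_increasing) auto
  then have 2: "Suc y \<le> b ^ Suc c * P" using y unfolding P_def power_add by linarith
  have c: "Suc c \<le> b ^ c"
  proof -
    have "Suc c \<le> 2 ^ c" by (simp add: Suc_leI)
    also have "\<dots> \<le> b ^ c" using b by (intro power_mono) auto
    finally show ?thesis .
  qed
  have "Suc d ^ c \<le> b ^ c" using b by (intro power_mono) auto
  then have hb: "h \<le> b ^ c" using h by linarith
  have bb: "2 * b ^ c \<le> b ^ Suc c" using b by simp
  \<comment> \<open>For \<open>d = 0\<close> the factor \<open>P\<close> is \<open>1\<close>, but
    then \<open>h \<le> 1\<close>; for \<open>d > 0\<close> the factor \<open>P\<close> supplies a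
    second \<open>b ^ c\<close>.\<close>
  have 3: "h * (h + Suc c) \<le> b ^ Suc c * P"
  proof (cases d)
    case 0
    then have "h * (h + Suc c) \<le> 1 * (1 + Suc c)" using h by (intro mult_mono) auto
    also have "\<dots> \<le> 2 * b ^ c" using c by simp
    also note bb
    also have "b ^ Suc c \<le> b ^ Suc c * P" using P by simp
    finally show ?thesis .
  next
    case (Suc d')
    have "h * (h + Suc c) \<le> b ^ c * (2 * b ^ c)" using hb c by (intro mult_mono) auto
    also have "\<dots> \<le> b ^ Suc c * b ^ c" using bb by (metis mult.commute mult_le_mono1)
    also have "b ^ c \<le> P" unfolding P_def Suc using b by (intro power_increasing) auto
    finally show ?thesis by simp
  qed
  have "sum_list (map ((+) s) fs) = length fs * s + sum_list fs" for s and fs :: "nat list"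
    by (induction fs) auto
  then have "Suc (sum_list (exps (Suc d) (Suc c))) = x * Suc (h * Suc d) + Suc y + h * (h + Suc c)"
    by (simp add: x_def y_def h_def algebra_simps)
  also have "\<dots> \<le> 3 * (b ^ Suc c * P)" using 1 2 3 by linarith
  also have "\<dots> \<le> b * (b ^ Suc c * P)" using b by (intro mult_right_mono) auto
  also have "\<dots> = b ^ ((Suc c + 1) * Suc d)" by (simp add: P_def power_add algebra_simps)
  finally show ?case .
qed

section \<open>From the tree to the interval of integers\<close>

theorem mainTheorem1:
  fixes n c l m :: nat
    and f :: "nat set \<Rightarrow> nat"
    and r :: "nat rel"
  assumes "n \<ge> 1" and "c \<ge> 1"
    and "l = n * c"
    and "m = 2 ^ ((n + 1) ^ ((c + 1) * n))"
    and "f \<in> [{..<(2 * m - 1) ^ l}]\<^bsup>2\<^esup> \<rightarrow> {..<c}"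
    and "r \<subseteq> {..<n - 1} \<times> {..<n - 1}"
    and "strict_linear_order_on {..<n - 1} r"
  shows "\<exists>a :: nat \<Rightarrow> nat.
           strict_mono_on {..<n} a \<and>
           (\<forall>i<n. a i < (2 * m - 1) ^ l) \<and>
           (\<exists>k. \<forall>e \<in> [a ` {..<n}]\<^bsup>2\<^esup>. f e = k) \<and>
           inj_on (\<lambda>i. a (i + 1) - a i) {..<n - 1} \<and>
           (\<forall>i<n - 1. \<forall>j<n - 1. (i, j) \<in> r \<longrightarrow> a (i + 1) - a i < a (j + 1) - a j)"
proof -
  define d where "d = n - 1"
  have n: "n = Suc d" using assms(1) by (simp add: d_def)
  define E where "E = Suc (sum_list (exps d c))"
  \<comment> \<open>\<open>E\<close> exceeds every exponent, so the digits below
    \<open>B / 2\<close> suffice for each branching number.\<close>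
  define B :: nat where "B = 2 ^ E"
  have "2 * 2 ^ e \<le> B" if "e \<in> set (exps d c)" for e
  proof -
    have "e \<le> sum_list (exps d c)" using that by (simp add: member_le_sum_list)
    then have "(2::nat) ^ e \<le> 2 ^ sum_list (exps d c)" by (intro power_increasing) auto
    then show ?thesis by (simp add: B_def E_def)
  qed
  then obtain A where A: "tree B (exps d c) A" using tree_exists by blast
  \<comment> \<open>\<open>B ^ length (exps d c)\<close> is the power of two with this exponent, to
    be compared with the exponent of \<open>m\<close>.\<close>
  have "E * length (exps d c) \<le> (n + 1) ^ ((c + 1) * d) * (n + 1) ^ c"
  proof (rule mult_mono)
    show "E \<le> (n + 1) ^ ((c + 1) * d)" unfolding E_def by (rule Suc_sum_exps) (simp add: n)
    have "d ^ c \<le> (n + 1) ^ c" by (intro power_mono) (auto simp: n)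
    then show "length (exps d c) \<le> (n + 1) ^ c" using length_exps le_trans by blast
  qed auto
  also have "\<dots> = (n + 1) ^ ((c + 1) * d + c)" by (simp add: power_add)
  also have "\<dots> \<le> (n + 1) ^ ((c + 1) * n)" by (intro power_increasing) (auto simp: n)
  finally have "B ^ length (exps d c) \<le> m"
    unfolding B_def assms(4) power_mult[symmetric] by (intro power_increasing) auto
  also have "m \<le> 2 * m - 1" using assms(4) by simp
  also have "\<dots> \<le> (2 * m - 1) ^ l"
  proof (rule self_le_power)
    have "1 \<le> m" by (simp add: assms(4))
    then show "1 \<le> 2 * m - 1" by linarith
    show "0 < l" using assms(1-3) by simp
  qed
  finally have bound: "B ^ length (exps d c) \<le> (2 * m - 1) ^ l" .
  have AN: "x < (2 * m - 1) ^ l" if "x \<in> A" for x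
    using tree_bound[OF A that] bound by linarith
  \<comment> \<open>Counting predecessors turns \<open>r\<close> into ranks; transitivity and
    irreflexivity make them strictly increasing along \<open>r\<close>.\<close>
  define \<rho> where "\<rho> i = card {j. (j, i) \<in> r}" for i
  have r: "trans r" "irrefl r" "total_on {..<d} r"
    using assms(7) by (auto simp: strict_linear_order_on_def d_def)
  have \<rho>: "\<rho> i < \<rho> j" if "(i, j) \<in> r" for i j
  proof -
    have "{k. (k, j) \<in> r} \<subseteq> {..<n - 1}" using assms(6) by auto
    then have "finite {k. (k, j) \<in> r}" by (rule finite_subset) simp
    moreover have "{k. (k, i) \<in> r} \<subset> {k. (k, j) \<in> r}"
      using that r(1,2) by (auto dest: transD simp: irrefl_def)
    ultimately show ?thesis unfolding \<rho>_def by (rule psubset_card_mono)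
  qed
  have "f {x, y} \<in> {..<c}" if "x \<in> A" "y \<in> A" "x < y" for x y
  proof -
    have "{x, y} \<in> [{..<(2 * m - 1) ^ l}]\<^bsup>2\<^esup>" using that AN by (auto simp: nsets_def card_2_iff)
    then show ?thesis using assms(5) by blast
  qed
  then obtain a k where aA: "\<forall>i\<le>d. a i \<in> A" and a: "ordered_clique (\<lambda>x y. f {x, y}) \<rho> d k a"
    using ordered_clique_in_tree[OF A, of "{..<c}" "\<lambda>x y. f {x, y}" \<rho>] assms(2) by auto
  have less: "a (i + 1) - a i < a (j + 1) - a j" if "i < d" "j < d" "(i, j) \<in> r" for i j
    using a \<rho> that by (simp add: ordered_clique_def)
  have mono: "a i < a j" if "i < j" "j < n" for i j
    using ordered_clique_strict_mono[OF a that(1)] that(2) n by simp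
  have "f e = k" if "e \<in> [a ` {..<n}]\<^bsup>2\<^esup>" for e
  proof -
    from that obtain i j where ij: "i < n" "j < n" "e = {a i, a j}" "a i \<noteq> a j"
      by (auto simp: nsets_def card_2_iff)
    have col: "f {a i, a j} = k" if "i < j" "j < n" for i j
      using a that n by (simp add: ordered_clique_def)
    show ?thesis using col[of i j] col[of j i] ij
      by (cases i j rule: linorder_cases) (auto simp: insert_commute)
  qed
  \<comment> \<open>Distinct indices are comparable by totality of \<open>r\<close>, so their
    differences are strictly ordered and cannot coincide.\<close>
  moreover have "inj_on (\<lambda>i. a (i + 1) - a i) {..<n - 1}"
  proof (rule inj_onI, rule ccontr)
    fix i j assume ij: "i \<in> {..<n - 1}" "j \<in> {..<n - 1}" "a (i + 1) - a i = a (j + 1) - a j" "i \<noteq> j"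
    then have "(i, j) \<in> r \<or> (j, i) \<in> r" using r(3) by (auto simp: total_on_def d_def)
    then show False using less[of i j] less[of j i] ij by (auto simp: d_def)
  qed
  moreover have "strict_mono_on {..<n} a" using mono by (auto simp: strict_mono_on_def)
  moreover have "\<forall>i<n. a i < (2 * m - 1) ^ l" using aA AN n by simp
  ultimately show ?thesis using less unfolding d_def by blast
qed

end
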